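(* For every $i\ge 2$, the ideal $M_i(A_2)$ is finitely generated as a two-sided ideal of $A_2$, namely by the set $\mathcal{S}_i$ of all pure-commutator products consisting of pure commutators of length at least two that have a maximal inclusion in $M_i(A_2)$.
   Context: $\mathcal{K}$ is a field of characteristic zero, and $A_2$ is the free associative unitary $\mathcal{K}$-algebra on generators $x_1,x_2$. Put $[a,b]=ab-ba$, and norm longer commutators to the right: $[a_1,a_2,\dots,a_m]=[a_1,[a_2,\dots,a_m]]$. Define $L_1(A_2)=A_2$ and, for $i\ge 2$, $L_i(A_2)=[A_2,L_{i-1}(A_2)]$ (linear span of commutators). Let $M_i(A_2)=A_2\cdot L_i(A_2)\cdot A_2$ be the two-sided ideal generated by $L_i(A_2)$. A pure commutator of length $m$ is a nonzero commutator $[x_{j_1},\dots,x_{j_m}]$ with a single generator in each slot (a single generator $x_j$ is a pure commutator of length one). A pure-commutator product is a finite product of pure commutators (zero is not counted). A pure-commutator product $p$ has a maximal inclusion in $M_l(A_2)$ if $p\in M_l(A_2)$ and $p\notin M_{l+1}(A_2)$. *)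

theory Defs
  imports Complex_Main "HOL-Library.Poly_Mapping"
begin

section \<open>The free associative unital algebra\<close>

text \<open>The free associative unital algebra over \<open>'k\<close> on the generators \<open>'g\<close> is the monoid algebra of
  the free monoid on \<open>'g\<close>: finitely supported functions from words to \<open>'k\<close>, with convolution as
  product. The free monoid is written additively because the convolution product of
  \<open>Poly_Mapping\<close> is stated for the class \<open>monoid_add\<close>; lists are wrapped in a type of their own to
  carry that instance.\<close>

datatype 'g free_monoid = Word (letters: "'g list")

instantiation free_monoid :: (type) monoid_add
begin

definition zero_free_monoid :: "'g free_monoid"
  where "zero_free_monoid = Word []"

definition plus_free_monoid :: "'g free_monoid \<Rightarrow> 'g free_monoid \<Rightarrow> 'g free_monoid"
  where "plus_free_monoid u v = Word (letters u @ letters v)"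

instance
  by standard (simp_all add: zero_free_monoid_def plus_free_monoid_def)

end

type_synonym ('g, 'k) free_algebra = "'g free_monoid \<Rightarrow>\<^sub>0 'k"

definition gen :: "'g \<Rightarrow> ('g, 'k::zero_neq_one) free_algebra"
  where "gen j = Poly_Mapping.single (Word [j]) 1"

definition scale :: "'k \<Rightarrow> ('g, 'k::field) free_algebra \<Rightarrow> ('g, 'k) free_algebra"
  where "scale c p = Poly_Mapping.single 0 c * p"

global_interpretation free_algebra: vector_space scale
  defines lin_span = free_algebra.span
  by standard
    (simp_all add: scale_def algebra_simps single_add mult_single flip: mult.assoc)

datatype two = X1 | X2

type_synonym 'k A2 = "(two, 'k) free_algebra"


section \<open>Commutators and two-sided ideals\<close>

definition commutator :: "'a::ring \<Rightarrow> 'a \<Rightarrow> 'a"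
  where "commutator a b = a * b - b * a"

text \<open>Right-normed: \<open>[a\<^sub>1, a\<^sub>2, \<dots>, a\<^sub>m] = [a\<^sub>1, [a\<^sub>2, \<dots>, a\<^sub>m]]\<close>. The value on the empty list is never
  used.\<close>

fun commutator_list :: "'a::ring list \<Rightarrow> 'a" where
  "commutator_list [] = 0"
| "commutator_list [a] = a"
| "commutator_list (a # b # cs) = commutator a (commutator_list (b # cs))"

definition two_sided_ideal :: "'a::ring_1 set \<Rightarrow> bool"
  where "two_sided_ideal I \<longleftrightarrow> 0 \<in> I \<and> (\<forall>x\<in>I. \<forall>y\<in>I. x + y \<in> I) \<and>
    (\<forall>a. \<forall>x\<in>I. a * x \<in> I \<and> x * a \<in> I)"

definition ideal_generated_by :: "'a::ring_1 set \<Rightarrow> 'a set"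
  where "ideal_generated_by S = two_sided_ideal hull S"


section \<open>The lower central series and its ideals\<close>

text \<open>The series starts at index \<open>1\<close>; index \<open>0\<close> is a dummy.\<close>

fun L :: "nat \<Rightarrow> ('g, 'k::field) free_algebra set" where
  "L 0 = UNIV"
| "L (Suc 0) = UNIV"
| "L (Suc (Suc n)) = lin_span {commutator a b | a b. b \<in> L (Suc n)}"

definition M :: "nat \<Rightarrow> ('g, 'k::field) free_algebra set"
  where "M i = ideal_generated_by (L i)"


section \<open>Pure commutators\<close>

definition pure_commutator :: "nat \<Rightarrow> ('g, 'k::field) free_algebra \<Rightarrow> bool"
  where "pure_commutator m c \<longleftrightarrow>
    (\<exists>js. length js = m \<and> m \<ge> 1 \<and> c = commutator_list (map gen js) \<and> c \<noteq> 0)"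

text \<open>The empty product is excluded; this does not affect \<open>S i\<close> for \<open>i \<ge> 2\<close>, since \<open>M i\<close> is then
  contained in the augmentation ideal and does not contain \<open>1\<close>.\<close>

definition pure_commutator_product_ge2 :: "('g, 'k::field) free_algebra \<Rightarrow> bool"
  where "pure_commutator_product_ge2 p \<longleftrightarrow>
    (\<exists>cs. cs \<noteq> [] \<and> (\<forall>c\<in>set cs. \<exists>m\<ge>2. pure_commutator m c) \<and> p = prod_list cs \<and> p \<noteq> 0)"

definition maximal_inclusion :: "nat \<Rightarrow> ('g, 'k::field) free_algebra \<Rightarrow> bool"
  where "maximal_inclusion l p \<longleftrightarrow> p \<in> M l \<and> p \<notin> M (Suc l)"

definition S :: "nat \<Rightarrow> ('g, 'k::field) free_algebra set"
  where "S i = {p. pure_commutator_product_ge2 p \<and> maximal_inclusion i p}"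

end

theory Submission
  imports Defs
begin

text \<open>Give a product of pure commutators of lengths \<open>m\<^sub>1, \<dots>, m\<^sub>k\<close> (generators allowed) the weight
  \<open>\<Sum> (m\<^sub>j - 1)\<close>; commuting a generator past a product raises the weight by one. On two generators
  \<open>[A, A] M\<^sub>n \<subseteq> M\<^sub>n\<^sub>+\<^sub>1\<close>, so \<open>[A, M\<^sub>n] \<subseteq> M\<^sub>n\<^sub>+\<^sub>1\<close>, and the identity
  \<open>[x, c] u = [x, c u] - c [x, u]\<close> then shows that \<open>M\<^sub>n\<^sub>+\<^sub>1\<close> is exactly the span of the products of weight
  at least \<open>n\<close>. This bounds the weight, hence the number, of the products with maximal inclusion in
  \<open>M\<^sub>n\<^sub>+\<^sub>1\<close>. That these generate all products of weight at least \<open>n\<close> follows by induction on the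
  degree: a product of larger weight reduces to products of smaller degree by the same identity,
  and a product of weight \<open>n\<close> that happens to lie in \<open>M\<^sub>n\<^sub>+\<^sub>2\<close> is, by homogeneity, a combination of
  products of larger weight and the same degree.\<close>

section \<open>Two-sided ideals, commutator identities and scalars in the free algebra\<close>

lemma ideal_zero: "two_sided_ideal I \<Longrightarrow> 0 \<in> I"
  and ideal_add: "two_sided_ideal I \<Longrightarrow> x \<in> I \<Longrightarrow> y \<in> I \<Longrightarrow> x + y \<in> I"
  and ideal_mult_left: "two_sided_ideal I \<Longrightarrow> x \<in> I \<Longrightarrow> a * x \<in> I"
  and ideal_mult_right: "two_sided_ideal I \<Longrightarrow> x \<in> I \<Longrightarrow> x * a \<in> I"
  by (auto simp: two_sided_ideal_def)

lemma ideal_uminus: "two_sided_ideal I \<Longrightarrow> x \<in> I \<Longrightarrow> - x \<in> I"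
  using ideal_mult_left[of I x "- 1"] by simp

lemma ideal_diff: "two_sided_ideal I \<Longrightarrow> x \<in> I \<Longrightarrow> y \<in> I \<Longrightarrow> x - y \<in> I"
  using ideal_add[of I x "- y"] ideal_uminus[of I y] by simp

lemmas ideal_closed = ideal_zero ideal_add ideal_diff ideal_uminus ideal_mult_left ideal_mult_right

lemma ideal_generated_by_ideal: "two_sided_ideal (ideal_generated_by A)"
  unfolding ideal_generated_by_def by (rule hull_in) (auto simp: two_sided_ideal_def)

lemma ideal_generated_by_base: "x \<in> A \<Longrightarrow> x \<in> ideal_generated_by A"
  unfolding ideal_generated_by_def by (rule hull_inc)

lemma ideal_generated_by_minimal: "two_sided_ideal I \<Longrightarrow> A \<subseteq> I \<Longrightarrow> ideal_generated_by A \<subseteq> I"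
  unfolding ideal_generated_by_def by (rule hull_minimal)

lemma ideal_subspace: "two_sided_ideal I \<Longrightarrow> free_algebra.subspace I"
  by (rule free_algebra.subspaceI) (auto simp: scale_def ideal_closed)

lemma commutator_mult_left: "commutator (a * b) c = a * commutator b c + commutator a c * b"
  and commutator_mult_right: "commutator a (b * c) = commutator a b * c + b * commutator a c"
  and commutator_add_left: "commutator (a + b) c = commutator a c + commutator b c"
  and commutator_add_right: "commutator a (b + c) = commutator a b + commutator a c"
  and commutator_swap: "commutator a b = - commutator b a"
  by (simp_all add: commutator_def algebra_simps)

lemma commutator_one [simp]: "commutator 1 a = 0" "commutator a 1 = (0 :: 'a::ring_1)"
  by (simp_all add: commutator_def)

lemma commutator_zero_right [simp]: "commutator a 0 = 0"
  by (simp add: commutator_def)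

text \<open>Words span the algebra and arise from \<open>1\<close> by left multiplication with
  generators. Together with the Leibniz rule this reduces claims about commutators to
  generators.\<close>

lemma free_algebra_induct [case_names one gen add scale]:
  fixes a :: "('g, 'k::field) free_algebra"
  assumes one: "P 1"
    and gen: "\<And>j y. P y \<Longrightarrow> P (gen j * y)"
    and add: "\<And>x y. P x \<Longrightarrow> P y \<Longrightarrow> P (x + y)"
    and scale: "\<And>c y. P y \<Longrightarrow> P (scale c y)"
  shows "P a"
proof -
  have word: "P (Poly_Mapping.single (Word ws) 1)" for ws :: "'g list"
  proof (induction ws)
    case Nil
    then show ?case using one by (metis single_one zero_free_monoid_def)
  next
    case (Cons j ws)
    have "Poly_Mapping.single (Word (j # ws)) (1::'k) = gen j * Poly_Mapping.single (Word ws) 1"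
      by (simp add: gen_def mult_single plus_free_monoid_def)
    then show ?case using gen[OF Cons] by simp
  qed
  have single: "P (Poly_Mapping.single w c)" for w c
  proof -
    have "Poly_Mapping.single w c = scale c (Poly_Mapping.single (Word (letters w)) 1)"
      by (simp add: scale_def mult_single)
    then show ?thesis using scale[OF word] by metis
  qed
  show ?thesis
  proof (induction a rule: update_induct)
    case const
    show ?case using scale[OF one, of 0] by (simp add: scale_def)
  next
    case (update f w c)
    have "Poly_Mapping.update w c f = f + Poly_Mapping.single w c"
      using update.hyps
      by (intro poly_mapping_eqI) (auto simp: lookup_update lookup_add lookup_single in_keys_iff when_def)
    then show ?case using add[OF update.IH single] by simp
  qed
qed

text \<open>Since \<open>scale\<close> is left multiplication by a constant, the point is that
  constants are central: they commute with generators, hence with everything.\<close>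

lemma mult_scale_right: "x * scale c y = scale c (x * y :: ('g, 'k::field) free_algebra)"
proof -
  let ?c = "Poly_Mapping.single 0 c :: ('g, 'k) free_algebra"
  have mult: "(x * y) * ?c = ?c * (x * y)" if "x * ?c = ?c * x" "y * ?c = ?c * y" for x y
  proof -
    have "(x * y) * ?c = x * (y * ?c)" by (rule mult.assoc)
    also have "\<dots> = (x * ?c) * y" unfolding that(2) by (rule mult.assoc[symmetric])
    also have "\<dots> = ?c * (x * y)" unfolding that(1) by (rule mult.assoc)
    finally show ?thesis .
  qed
  have "x * ?c = ?c * x" for x
  proof (induction x rule: free_algebra_induct)
    case (gen j y)
    show ?case by (rule mult[OF _ gen]) (simp add: gen_def mult_single)
  next
    case (scale d y)
    show ?case unfolding scale_def by (rule mult[OF _ scale]) (simp add: mult_single mult.commute)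
  qed (simp_all add: algebra_simps)
  then show ?thesis unfolding scale_def by (simp flip: mult.assoc)
qed

lemma mult_scale_left: "scale c x * y = scale c (x * y)"
  by (simp add: scale_def mult.assoc)

lemma commutator_scale:
  "commutator (scale c x) y = scale c (commutator x y)"
  "commutator x (scale c y) = scale c (commutator x y)"
  by (simp_all add: commutator_def mult_scale_left mult_scale_right free_algebra.scale_right_diff_distrib)

lemma ideal_scale: "two_sided_ideal I \<Longrightarrow> x \<in> I \<Longrightarrow> scale c x \<in> I"
  by (simp add: scale_def ideal_mult_left)


section \<open>The lower central series and its ideals\<close>

lemma L_Suc: "n \<ge> 1 \<Longrightarrow> L (Suc n) = lin_span {commutator a b | a b. b \<in> L n}"
  by (cases n) auto

lemma commutator_in_L: "n \<ge> 1 \<Longrightarrow> b \<in> L n \<Longrightarrow> commutator a b \<in> L (Suc n)"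
  by (auto simp: L_Suc intro: free_algebra.span_base)

lemma L_Suc_subset: "n \<ge> 1 \<Longrightarrow> L (Suc n) \<subseteq> L n"
proof (induction n rule: nat_induct_at_least)
  case (Suc n)
  then show ?case
    unfolding L_Suc[OF Suc(1)] L_Suc[OF le_SucI[OF Suc(1)]] by (intro free_algebra.span_mono) blast
qed simp

lemma L_Suc_subset_subspace:
  assumes "n \<ge> 1" "free_algebra.subspace V" "\<And>a b. b \<in> L n \<Longrightarrow> commutator a b \<in> V"
  shows "L (Suc n) \<subseteq> V"
  unfolding L_Suc[OF assms(1)] using assms by (intro free_algebra.span_minimal) auto

lemma M_ideal: "two_sided_ideal (M n)"
  unfolding M_def by (rule ideal_generated_by_ideal)

lemma L_in_M: "x \<in> L n \<Longrightarrow> x \<in> M n"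
  unfolding M_def by (rule ideal_generated_by_base)

lemma M_minimal: "two_sided_ideal I \<Longrightarrow> L n \<subseteq> I \<Longrightarrow> M n \<subseteq> I"
  unfolding M_def by (rule ideal_generated_by_minimal)

lemma M_1: "M (Suc 0) = UNIV"
  using L_in_M[of _ "Suc 0"] by auto

lemma M_antimono: "1 \<le> m \<Longrightarrow> m \<le> n \<Longrightarrow> M n \<subseteq> M m"
proof (rotate_tac, induction n rule: dec_induct)
  case (step n)
  have "M (Suc n) \<subseteq> M n"
    using L_Suc_subset[of n] step by (intro M_minimal M_ideal) (auto intro: L_in_M)
  then show ?case using step by blast
qed simp

text \<open>A left factor can be moved across: \<open>a l = l a + [a, l]\<close>, and
  \<open>[a, l]\<close> stays in \<open>L n\<close> because the series decreases.\<close>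

lemma M_subset_span: "n \<ge> 1 \<Longrightarrow> M n \<subseteq> lin_span {l * b | l b. l \<in> L n}"
proof -
  assume n: "n \<ge> 1"
  let ?R = "lin_span {l * b | l b. l \<in> L n} :: ('a, 'b) free_algebra set"
  have base: "l * b \<in> ?R" if "l \<in> L n" for l b
    using that by (auto intro: free_algebra.span_base)
  have right: "y * a \<in> ?R" if "y \<in> ?R" for y a
  proof -
    have "l * b * a \<in> ?R" if "l \<in> L n" for l b
      unfolding mult.assoc using that by (rule base)
    then have "?R \<subseteq> {y. y * a \<in> ?R}"
      by (intro free_algebra.span_minimal free_algebra.subspaceI)
        (auto simp: distrib_right mult_scale_left
          intro: free_algebra.span_zero free_algebra.span_add free_algebra.span_scale)
    then show ?thesis using that by blast
  qed
  have left: "a * y \<in> ?R" if "y \<in> ?R" for y a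
  proof -
    have "a * (l * b) \<in> ?R" if l: "l \<in> L n" for l b
    proof -
      have "a * (l * b) = l * (a * b) + commutator a l * b"
        by (simp add: commutator_def algebra_simps)
      moreover have "commutator a l \<in> L n"
        using commutator_in_L[OF n l] L_Suc_subset[OF n] by blast
      ultimately show ?thesis using base l by (simp add: free_algebra.span_add)
    qed
    then have "?R \<subseteq> {y. a * y \<in> ?R}"
      by (intro free_algebra.span_minimal free_algebra.subspaceI)
        (auto simp: distrib_left mult_scale_right
          intro: free_algebra.span_zero free_algebra.span_add free_algebra.span_scale)
    then show ?thesis using that by blast
  qed
  have "two_sided_ideal ?R"
    unfolding two_sided_ideal_def
    using left right by (auto intro: free_algebra.span_zero free_algebra.span_add)
  moreover have "L n \<subseteq> ?R"
    using base[of _ 1] by auto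
  ultimately show ?thesis by (rule M_minimal)
qed


section \<open>Products of the ideals on two generators\<close>

text \<open>Since \<open>[a, v]\<close> is already antisymmetric, this makes \<open>[a, v] [b, w]\<close> alternating in \<open>a, v, b\<close>
  modulo \<open>M (n + 2)\<close>; in characteristic other than two it then vanishes when \<open>a, v, b\<close> are taken
  from two generators.\<close>

lemma commutator_mult_alternating:
  assumes n: "n \<ge> 1" and w: "w \<in> L n"
  shows "commutator a v * commutator b w + commutator a b * commutator v w \<in> M (Suc (Suc n))"
proof -
  have double: "commutator p (commutator q w) \<in> M (Suc (Suc n))" for p q
    using n w by (intro L_in_M commutator_in_L) auto
  \<comment> \<open>The Leibniz rule expands the first double commutator; the last one reverses the
    order in the leftover \<open>[v, w] [a, b]\<close>.\<close>
  have "commutator a v * commutator b w + commutator a b * commutator v w =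
      commutator a (commutator (v * b) w) - v * commutator a (commutator b w)
      - commutator a (commutator v w) * b + commutator (commutator a b) (commutator v w)"
    by (simp add: commutator_def algebra_simps)
  then show ?thesis
    by (simp only:) (intro ideal_closed double M_ideal)
qed

text \<open>If \<open>b\<close> is a generator, it repeats \<open>X1\<close> or \<open>X2\<close>
  and the alternating relation applies; the general case follows by induction on \<open>b\<close>
  with the Leibniz rule.\<close>

lemma commutator_gens_mult_commutator:
  fixes b :: "'k::field_char_0 A2"
  assumes n: "n \<ge> 1" and w: "w \<in> L n"
  shows "commutator (gen X1) (gen X2) * commutator b w \<in> M (Suc (Suc n))"
proof -
  let ?M = "M (Suc (Suc n)) :: 'k A2 set"
  let ?e = "commutator (gen X1) (gen X2) :: 'k A2"
  note closed = ideal_closed[OF M_ideal]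
  note alt = commutator_mult_alternating[OF n w]
  have half: "y \<in> ?M" if "y + y \<in> ?M" for y
  proof -
    have "scale (1 / 2) (y + y) = y"
      by (simp flip: free_algebra.scale_left_distrib add: free_algebra.scale_right_distrib)
    then show ?thesis using ideal_scale[OF M_ideal that, of "1 / 2"] by simp
  qed
  \<comment> \<open>With \<open>v = b\<close> the two terms of \<open>alt\<close> coincide, so twice
    the product lies in \<open>?M\<close>; \<open>half\<close> then uses characteristic
    zero.\<close>
  have gens: "?e * commutator (gen j) w \<in> ?M" for j
  proof (cases j)
    case X1
    have "commutator (gen X2) (gen X1) * commutator (gen X1) w \<in> ?M"
      using half alt by blast
    then have "- (commutator (gen X2) (gen X1) * commutator (gen X1) w) \<in> ?M"
      by (rule closed)
    then show ?thesis using X1 by (simp add: commutator_swap[of "gen X1" "gen X2"])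
  next
    case X2
    then show ?thesis using half alt by blast
  qed
  have "commutator ?e w = commutator (gen X1) (commutator (gen X2) w) -
      commutator (gen X2) (commutator (gen X1) w)"
    by (simp add: commutator_def algebra_simps)
  then have e: "commutator ?e w \<in> ?M"
    using n w by (simp only:) (intro closed L_in_M commutator_in_L; simp)
  show ?thesis
  proof (induction b rule: free_algebra_induct)
    case one
    show ?case by (simp add: closed)
  next
    case (gen j b)
    \<comment> \<open>Moving \<open>gen j\<close> past \<open>?e\<close> leaves the cross term
      \<open>[gen j, ?e] [b, w]\<close>, which \<open>alt\<close> trades, up to sign, for
      \<open>[gen j, b] [?e, w]\<close>; fact \<open>e\<close> covers the latter.\<close>
    have "?e * commutator (gen j * b) w =
        gen j * (?e * commutator b w)
        - ((commutator (gen j) ?e * commutator b w + commutator (gen j) b * commutator ?e w)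
          - commutator (gen j) b * commutator ?e w)
        + (?e * commutator (gen j) w) * b"
      by (simp add: commutator_def algebra_simps)
    then show ?case
      by (simp only:) (intro closed gen gens e alt)
  next
    case (add x y)
    then show ?case by (simp add: commutator_add_left distrib_left closed)
  next
    case (scale c y)
    then show ?case by (simp add: commutator_scale mult_scale_right ideal_scale M_ideal)
  qed
qed

lemma commutator_gens_mult_M:
  fixes y :: "'k::field_char_0 A2"
  assumes n: "n \<ge> 1" and y: "y \<in> M n"
  shows "commutator (gen X1) (gen X2) * y \<in> M (Suc n)"
proof -
  let ?e = "commutator (gen X1) (gen X2) :: 'k A2"
  let ?V = "{y. ?e * y \<in> M (Suc n)}"
  have V: "free_algebra.subspace ?V"
    by (rule free_algebra.subspaceI)
      (auto simp: distrib_left mult_scale_right ideal_closed ideal_scale M_ideal)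
  have "L n \<subseteq> ?V"
  proof (cases "n = 1")
    case True
    \<comment> \<open>\<open>L 1\<close> is the whole algebra, not a span of commutators, so here
      the factor \<open>?e\<close> alone must supply the membership.\<close>
    have "?e \<in> M (Suc 1)"
      by (intro L_in_M commutator_in_L) auto
    then have "?e * y \<in> M (Suc 1)" for y
      by (rule ideal_mult_right[OF M_ideal])
    then show ?thesis using True by blast
  next
    case False
    then obtain m where m: "n = Suc m" "m \<ge> 1" using n by (cases n) auto
    have "?e * commutator a b \<in> M (Suc n)" if "b \<in> L m" for a b
      using commutator_gens_mult_commutator[OF m(2) that] m(1) by simp
    then have "L (Suc m) \<subseteq> ?V"
      by (intro L_Suc_subset_subspace[OF m(2) V]) simp
    then show ?thesis using m(1) by simp
  qed
  then have "{l * b | l b. l \<in> L n} \<subseteq> ?V"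
    by (auto simp: ideal_mult_right M_ideal simp flip: mult.assoc)
  then have "lin_span {l * b | l b. l \<in> L n} \<subseteq> ?V"
    using V by (rule free_algebra.span_minimal)
  then show ?thesis using M_subset_span[OF n] y by blast
qed

text \<open>Modulo \<open>I\<close> the generators commute, so the quotient is commutative.\<close>

lemma commutator_in_ideal:
  fixes I :: "('g, 'k::field) free_algebra set"
  assumes I: "two_sided_ideal I" and gens: "\<And>j k. commutator (gen j) (gen k) \<in> I"
  shows "commutator a b \<in> I"
proof -
  have gen: "commutator (gen j) b \<in> I" for j b
    by (induction b rule: free_algebra_induct)
      (auto simp: commutator_mult_right commutator_add_right commutator_scale gens
        ideal_closed ideal_scale I)
  show ?thesis
    by (induction a rule: free_algebra_induct)
      (auto simp: commutator_mult_left commutator_add_left commutator_scale gen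
        ideal_closed ideal_scale I)
qed

text \<open>The left multipliers carrying \<open>M n\<close> into \<open>M (n + 1)\<close> form a
  two-sided ideal, so only commutators of generators matter. With two generators these are
  \<open>0\<close> or, up to sign, \<open>[X1, X2]\<close>.\<close>

lemma commutator_mult_M:
  fixes y :: "'k::field_char_0 A2"
  assumes n: "n \<ge> 1" and y: "y \<in> M n"
  shows "commutator a b * y \<in> M (Suc n)"
proof -
  let ?K = "{z :: 'k A2. \<forall>y\<in>M n. z * y \<in> M (Suc n)}"
  have K: "two_sided_ideal ?K"
    unfolding two_sided_ideal_def by (auto simp: distrib_right mult.assoc ideal_closed M_ideal)
  have "commutator (gen j) (gen k) \<in> ?K" for j k
  proof -
    have e: "commutator (gen X1) (gen X2) \<in> ?K"
      using commutator_gens_mult_M[OF n] by blast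
    moreover have "commutator (gen X2) (gen X1) \<in> ?K"
      using ideal_uminus[OF K e] by (simp add: commutator_swap[of "gen X2"])
    moreover have "commutator (gen j) (gen j) \<in> ?K" for j
      using ideal_zero[OF K] by (simp add: commutator_def)
    ultimately show ?thesis by (cases j; cases k) blast+
  qed
  then show ?thesis using commutator_in_ideal[OF K, of a b] y by blast
qed

lemma commutator_M:
  fixes y :: "'k::field_char_0 A2"
  assumes n: "n \<ge> 1" and y: "y \<in> M n"
  shows "commutator a y \<in> M (Suc n)"
proof -
  \<comment> \<open>\<open>?K\<close> is shown to be an ideal containing \<open>L n\<close>. The
    quantifier over \<open>a\<close> belongs inside it, since closure under right multiplication
    needs the commutator of \<open>y\<close> with \<open>[a, b]\<close>.\<close>
  let ?K = "{y :: 'k A2. y \<in> M n \<and> (\<forall>a. commutator a y \<in> M (Suc n))}"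
  note closed = ideal_closed[OF M_ideal]
  have left: "commutator a (b * y) \<in> M (Suc n)" if "y \<in> ?K" for a b y
  proof -
    have "commutator a b * y \<in> M (Suc n)" "b * commutator a y \<in> M (Suc n)"
      using that by (simp_all add: commutator_mult_M[OF n] closed(5))
    then show ?thesis unfolding commutator_mult_right by (rule closed(2))
  qed
  have right: "commutator a (y * b) \<in> M (Suc n)" if "y \<in> ?K" for a b y
  proof -
    have "commutator a (y * b) =
        commutator a y * b + (commutator a b * y - commutator (commutator a b) y)"
      by (simp add: commutator_def algebra_simps)
    moreover have "commutator a y * b \<in> M (Suc n)"
      by (rule closed(6)) (use that in simp)
    moreover have "commutator a b * y \<in> M (Suc n)"
      by (rule commutator_mult_M[OF n]) (use that in simp)
    moreover have "commutator (commutator a b) y \<in> M (Suc n)"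
      using that by simp
    ultimately show ?thesis by (simp only: closed(2,3))
  qed
  have "two_sided_ideal ?K"
    unfolding two_sided_ideal_def using left right
    by (simp add: commutator_add_right closed(1,2) ideal_mult_left[OF M_ideal] ideal_mult_right[OF M_ideal])
  moreover have "L n \<subseteq> ?K"
    using L_in_M L_in_M[OF commutator_in_L[OF n]] by blast
  ultimately show ?thesis using M_minimal[of ?K n] y by blast
qed


section \<open>Products of pure commutators and their weight\<close>

text \<open>Products are encoded by lists of index lists because weight and degree are read off the
  factors and need not be determined by the element: \<open>[X1, X1]\<close> and
  \<open>[X1, X1, X1]\<close> are both \<open>0\<close>.\<close>

definition gens_commutator :: "'g list \<Rightarrow> ('g, 'k::field) free_algebra"
  where "gens_commutator js = commutator_list (map gen js)"

definition commutator_product :: "'g list list \<Rightarrow> ('g, 'k::field) free_algebra"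
  where "commutator_product jss = prod_list (map gens_commutator jss)"

definition weight :: "'g list list \<Rightarrow> nat"
  where "weight jss = (\<Sum>js\<leftarrow>jss. length js - 1)"

definition degree :: "'g list list \<Rightarrow> nat"
  where "degree jss = (\<Sum>js\<leftarrow>jss. length js)"

lemma gens_commutator_single [simp]: "gens_commutator [j] = gen j"
  by (simp add: gens_commutator_def)

lemma gens_commutator_Cons:
  "js \<noteq> [] \<Longrightarrow> gens_commutator (j # js) = commutator (gen j) (gens_commutator js)"
  by (cases js) (simp_all add: gens_commutator_def)

lemma commutator_product_simps [simp]:
  "commutator_product [] = 1"
  "commutator_product (js # jss) = gens_commutator js * commutator_product jss"
  "commutator_product (jss @ kss) = commutator_product jss * commutator_product kss"
  by (simp_all add: commutator_product_def)

lemma weight_simps [simp]: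
  "weight [] = 0" "weight (js # jss) = length js - 1 + weight jss"
  "weight (jss @ kss) = weight jss + weight kss"
  by (simp_all add: weight_def)

lemma degree_simps [simp]:
  "degree [] = 0" "degree (js # jss) = length js + degree jss"
  "degree (jss @ kss) = degree jss + degree kss"
  by (simp_all add: degree_def)

text \<open>By the Leibniz rule, \<open>[x, P]\<close> is a sum of products with one factor
  \<open>c\<close> replaced by \<open>[x, c]\<close>. The context \<open>a\<close>, \<open>b\<close>
  lets the induction absorb leading factors into \<open>a\<close> and lets later uses keep fixed
  outer factors.\<close>

lemma commutator_product_derivation:
  fixes I :: "('g, 'k::field) free_algebra set" and jss :: "'g list list"
  assumes closed: "0 \<in> I" "\<And>x y. x \<in> I \<Longrightarrow> y \<in> I \<Longrightarrow> x + y \<in> I"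
    and mem: "\<And>kss. [] \<notin> set kss \<Longrightarrow> weight kss = Suc (weight jss) \<Longrightarrow>
      degree kss = Suc (degree jss) \<Longrightarrow> a * commutator_product kss * b \<in> I"
    and nonempty: "[] \<notin> set jss"
  shows "a * commutator (gen j) (commutator_product jss) * b \<in> I"
  using mem nonempty
proof (induction jss arbitrary: a)
  case Nil
  then show ?case by (simp add: closed)
next
  case (Cons js jss)
  have "a * (gens_commutator (j # js) * commutator_product jss) * b \<in> I"
    using Cons.prems(1)[of "(j # js) # jss"] Cons.prems(2) by auto
  moreover have "(a * gens_commutator js) * commutator (gen j) (commutator_product jss) * b \<in> I"
  proof (rule Cons.IH)
    fix kss :: "'g list list"
    assume "[] \<notin> set kss" "weight kss = Suc (weight jss)" "degree kss = Suc (degree jss)"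
    then show "a * gens_commutator js * commutator_product kss * b \<in> I"
      using Cons.prems(1)[of "js # kss"] Cons.prems(2) by (simp add: mult.assoc)
  qed (use Cons.prems(2) in auto)
  moreover have "a * commutator (gen j) (commutator_product (js # jss)) * b =
      a * (gens_commutator (j # js) * commutator_product jss) * b
      + (a * gens_commutator js) * commutator (gen j) (commutator_product jss) * b"
    using Cons.prems(2)
    by (cases "js = []")
      (simp_all add: commutator_mult_right gens_commutator_Cons distrib_left distrib_right mult.assoc)
  ultimately show ?case by (simp only: closed(2))
qed

text \<open>In \<open>[x, c] u = [x, c u] - c [x, u]\<close> the outer bracket gains one index, and
  so does \<open>[x, u]\<close>; hence the induction needs arbitrary \<open>n\<close> and
  \<open>u\<close>.\<close>

lemma gens_commutator_mult_M:
  fixes u :: "'k::field_char_0 A2"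
  assumes "js \<noteq> []" "n \<ge> 1" "u \<in> M n"
  shows "gens_commutator js * u \<in> M (n + (length js - 1))"
  using assms
proof (induction js arbitrary: n u rule: list_nonempty_induct)
  case (single j)
  then show ?case by (simp add: ideal_mult_left M_ideal)
next
  case (cons j js)
  let ?c = "gens_commutator js :: 'k A2"
  define m where "m = n + (length js - 1)"
  have m: "m \<ge> 1" "n + (length (j # js) - 1) = Suc m" "Suc n + (length js - 1) = Suc m"
    using cons.prems cons.hyps by (cases js; auto simp: m_def)+
  have "commutator (gen j) (?c * u) \<in> M (Suc m)"
    using cons.IH[OF cons.prems] m by (intro commutator_M) (auto simp: m_def)
  moreover have "?c * commutator (gen j) u \<in> M (Suc m)"
    using cons.IH[OF _ commutator_M[OF cons.prems]] m by (metis le_SucI cons.prems(1))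
  moreover have "gens_commutator (j # js) * u =
      commutator (gen j) (?c * u) - ?c * commutator (gen j) u"
    using cons.hyps by (simp add: gens_commutator_Cons commutator_mult_right)
  ultimately show ?case using m by (simp add: ideal_diff M_ideal)
qed

text \<open>Factors are added from the left, starting with the empty product in \<open>M 1\<close>;
  this start causes the shift by one.\<close>

lemma commutator_product_in_M:
  "[] \<notin> set jss \<Longrightarrow> (commutator_product jss :: 'k::field_char_0 A2) \<in> M (Suc (weight jss))"
proof (induction jss)
  case (Cons js jss)
  have "gens_commutator js * commutator_product jss
      \<in> (M (Suc (weight jss) + (length js - 1)) :: 'k A2 set)"
    by (rule gens_commutator_mult_M) (use Cons in auto)
  then show ?case by (simp add: add.commute)
qed (simp add: M_1)

text \<open>The filtration by weight, which on two generators in characteristic zero coincides with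
  \<open>M (Suc n)\<close>.\<close>

definition weight_space :: "nat \<Rightarrow> ('g, 'k::field) free_algebra set"
  where "weight_space n =
    lin_span {commutator_product jss | jss. [] \<notin> set jss \<and> n \<le> weight jss}"

lemma weight_space_base:
  "[] \<notin> set jss \<Longrightarrow> n \<le> weight jss \<Longrightarrow> commutator_product jss \<in> weight_space n"
  unfolding weight_space_def by (rule free_algebra.span_base) auto

lemma weight_space_subspace: "free_algebra.subspace (weight_space n)"
  unfolding weight_space_def by (rule free_algebra.subspace_span)

lemmas weight_space_closed =
  weight_space_subspace[THEN free_algebra.subspace_0]
  weight_space_subspace[THEN free_algebra.subspace_add]
  weight_space_subspace[THEN free_algebra.subspace_scale]

lemma weight_space_minimal:
  assumes "free_algebra.subspace V"
    and "\<And>jss. [] \<notin> set jss \<Longrightarrow> n \<le> weight jss \<Longrightarrow> commutator_product jss \<in> V"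
  shows "weight_space n \<subseteq> V"
  unfolding weight_space_def using assms by (intro free_algebra.span_minimal) auto

lemma weight_space_mult:
  assumes x: "x \<in> weight_space m" and y: "y \<in> weight_space n"
  shows "x * y \<in> weight_space (m + n)"
proof -
  have left: "commutator_product jss * y \<in> weight_space (m + n)"
    if "[] \<notin> set jss" "m \<le> weight jss" for jss
  proof -
    have "commutator_product jss * commutator_product kss \<in> weight_space (m + n)"
      if "[] \<notin> set kss" "n \<le> weight kss" for kss
      using weight_space_base[of "jss @ kss" "m + n"] that \<open>[] \<notin> set jss\<close> \<open>m \<le> weight jss\<close>
      by simp
    then have "weight_space n \<subseteq> {y. commutator_product jss * y \<in> weight_space (m + n)}"
      by (intro weight_space_minimal free_algebra.subspaceI)
        (auto simp: distrib_left mult_scale_right weight_space_closed)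
    then show ?thesis using y by blast
  qed
  then have "weight_space m \<subseteq> {x. x * y \<in> weight_space (m + n)}"
    by (intro weight_space_minimal free_algebra.subspaceI)
      (auto simp: distrib_right mult_scale_left weight_space_closed)
  then show ?thesis using x by blast
qed

lemma weight_space_0: "a \<in> weight_space 0"
proof (induction a rule: free_algebra_induct)
  case one
  show ?case using weight_space_base[of "[]" 0] by simp
next
  case (gen j y)
  have "gen j \<in> weight_space 0" using weight_space_base[of "[[j]]" 0] by simp
  then show ?case using weight_space_mult[OF _ gen] by fastforce
qed (auto intro: weight_space_closed)

lemma weight_space_ideal: "two_sided_ideal (weight_space n)"
  unfolding two_sided_ideal_def
  using weight_space_mult[OF weight_space_0, of _ n] weight_space_mult[OF _ weight_space_0, of _ n]
  by (auto simp: weight_space_closed(1,2))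

text \<open>For a generator in the first slot the Leibniz rule raises the weight of every product by
  one; induction on \<open>a\<close> extends this, as the target is an ideal.\<close>

lemma commutator_weight_space:
  assumes y: "y \<in> weight_space n"
  shows "commutator a y \<in> weight_space (Suc n)"
proof (induction a rule: free_algebra_induct)
  case (gen j a)
  have "commutator (gen j) (commutator_product jss) \<in> weight_space (Suc n)"
    if "[] \<notin> set jss" "n \<le> weight jss" for jss
  proof -
    have "1 * commutator (gen j) (commutator_product jss) * 1 \<in> weight_space (Suc n)"
      using that
      by (intro commutator_product_derivation) (auto intro: weight_space_closed weight_space_base)
    then show ?thesis by simp
  qed
  then have "weight_space n \<subseteq> {y. commutator (gen j) y \<in> weight_space (Suc n)}"
    by (intro weight_space_minimal free_algebra.subspaceI)
      (auto simp: commutator_add_right commutator_scale weight_space_closed)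
  then have "commutator (gen j) y \<in> weight_space (Suc n)" using y by blast
  then show ?case
    unfolding commutator_mult_left
    by (intro ideal_add[OF weight_space_ideal] ideal_mult_left[OF weight_space_ideal gen]
        ideal_mult_right[OF weight_space_ideal])
qed (auto simp: commutator_add_left commutator_scale weight_space_closed)

lemma L_subset_weight_space: "L (Suc n) \<subseteq> weight_space n"
proof (induction n)
  case 0
  then show ?case using weight_space_0 by blast
next
  case (Suc n)
  then show ?case
    by (intro L_Suc_subset_subspace weight_space_subspace commutator_weight_space) auto
qed

lemma M_subset_weight_space: "M (Suc n) \<subseteq> weight_space n"
  by (intro M_minimal weight_space_ideal L_subset_weight_space)


section \<open>Homogeneous components\<close>

definition homogeneous :: "nat \<Rightarrow> ('g, 'k::field) free_algebra \<Rightarrow> bool"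
  where "homogeneous d y \<longleftrightarrow> (\<forall>w\<in>Poly_Mapping.keys y. length (letters w) = d)"

definition component :: "nat \<Rightarrow> ('g, 'k::field) free_algebra \<Rightarrow> ('g, 'k) free_algebra"
  where "component d = Poly_Mapping.mapp (\<lambda>w c. c when length (letters w) = d)"

lemma lookup_component:
  "Poly_Mapping.lookup (component d y) w =
    (Poly_Mapping.lookup y w when length (letters w) = d)"
  by (auto simp: component_def lookup_mapp when_def in_keys_iff)

lemma lookup_scale: "Poly_Mapping.lookup (scale c y) w = c * Poly_Mapping.lookup y w"
proof -
  have "scale c y = Poly_Mapping.map ((*) c) y"
    unfolding scale_def by (rule mult_map_scale_conv_mult[symmetric])
  then show ?thesis by (simp add: Poly_Mapping.map.rep_eq when_def)
qed

lemma component_linear: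
  "component d 0 = 0"
  "component d (x + y) = component d x + component d y"
  "component d (scale c x) = scale c (component d x)"
  by (auto intro!: poly_mapping_eqI simp: lookup_component lookup_add lookup_scale when_def)

lemma component_homogeneous:
  "homogeneous e y \<Longrightarrow> component d y = (if d = e then y else 0)"
  by (intro poly_mapping_eqI)
    (auto simp: lookup_component homogeneous_def in_keys_iff when_def)

lemma homogeneous_mult:
  "homogeneous d x \<Longrightarrow> homogeneous e y \<Longrightarrow> homogeneous (d + e) (x * y)"
  unfolding homogeneous_def using keys_mult[of x y]
  by (fastforce simp: plus_free_monoid_def)

lemma homogeneous_diff:
  "homogeneous d x \<Longrightarrow> homogeneous d y \<Longrightarrow> homogeneous d (x - y)"
  unfolding homogeneous_def using keys_diff[of x y] by blast

lemma homogeneous_gen: "homogeneous 1 (gen j)"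
  by (simp add: homogeneous_def gen_def)

lemma homogeneous_gens_commutator: "js \<noteq> [] \<Longrightarrow> homogeneous (length js) (gens_commutator js)"
proof (induction js rule: list_nonempty_induct)
  case (single j)
  then show ?case using homogeneous_gen by simp
next
  case (cons j js)
  then show ?case
    using homogeneous_mult[OF homogeneous_gen cons.IH, of j]
      homogeneous_mult[OF cons.IH homogeneous_gen, of j]
    by (simp add: gens_commutator_Cons commutator_def homogeneous_diff)
qed

lemma homogeneous_commutator_product:
  "[] \<notin> set jss \<Longrightarrow> homogeneous (degree jss) (commutator_product jss)"
proof (induction jss)
  case Nil
  then show ?case by (simp add: homogeneous_def zero_free_monoid_def)
next
  case (Cons js jss)
  then show ?case by (auto intro!: homogeneous_mult homogeneous_gens_commutator)
qed

text \<open>Projection to degree \<open>d\<close> fixes \<open>y\<close> and kills products of other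
  degrees, so only products of degree \<open>d\<close> are needed to express
  \<open>y\<close>.\<close>

lemma homogeneous_weight_space:
  fixes y :: "('g, 'k::field) free_algebra"
  assumes V: "free_algebra.subspace V"
    and y: "y \<in> weight_space n" "homogeneous d y"
    and mem: "\<And>jss. [] \<notin> set jss \<Longrightarrow> n \<le> weight jss \<Longrightarrow> degree jss = d \<Longrightarrow>
      commutator_product jss \<in> V"
  shows "y \<in> V"
proof -
  have "weight_space n \<subseteq> {y. component d y \<in> V}"
  proof (intro weight_space_minimal free_algebra.subspaceI)
    fix jss :: "'g list list"
    assume jss: "[] \<notin> set jss" "n \<le> weight jss"
    have "component d (commutator_product jss :: ('g, 'k) free_algebra) =
        (if d = degree jss then commutator_product jss else 0)"
      by (rule component_homogeneous[OF homogeneous_commutator_product[OF jss(1)]])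
    then show "commutator_product jss \<in> {y. component d y \<in> V}"
      using mem[OF jss] free_algebra.subspace_0[OF V] by auto
  qed (auto simp: component_linear free_algebra.subspace_0[OF V] free_algebra.subspace_add[OF V]
      free_algebra.subspace_scale[OF V])
  then have "component d y \<in> V" using y(1) by blast
  then show ?thesis using component_homogeneous[OF y(2), of d] by simp
qed


section \<open>Generation by pure-commutator products\<close>

text \<open>Induction on the length of the first factor: writing it as \<open>[x, c]\<close>, the product \<open>[x, c] P\<close> is
  \<open>[x, c P] - c [x, P]\<close>, where \<open>c P\<close> has smaller degree and the first factor of \<open>c [x, P]\<close> is shorter.\<close>

lemma commutator_product_weight_reduction:
  assumes I: "two_sided_ideal I"
    and less: "\<And>kss. [] \<notin> set kss \<Longrightarrow> n \<le> weight kss \<Longrightarrow> degree kss < d \<Longrightarrow>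
      commutator_product kss \<in> I"
    and jss: "[] \<notin> set jss" "Suc n \<le> weight jss" "degree jss \<le> d"
  shows "commutator_product jss \<in> I"
proof -
  note closed = ideal_closed[OF I]
  have "commutator_product (js # kss) \<in> I"
    if "js \<noteq> []" "[] \<notin> set kss" "Suc n \<le> weight (js # kss)" "degree (js # kss) \<le> d" for js kss
    using that
  proof (induction js arbitrary: kss rule: list_nonempty_induct)
    case (single j)
    then show ?case using less[of kss] by (simp add: closed)
  next
    case (cons j js)
    have "commutator_product (js # kss) \<in> I"
      using less[of "js # kss"] cons.prems cons.hyps by auto
    then have "gens_commutator js * commutator_product kss \<in> I" by simp
    then have "commutator (gen j) (gens_commutator js * commutator_product kss) \<in> I"
      unfolding commutator_def using ideal_diff[OF I] ideal_mult_left[OF I] ideal_mult_right[OF I]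
      by meson
    moreover have "gens_commutator js * commutator (gen j) (commutator_product kss) * 1 \<in> I"
    proof (rule commutator_product_derivation)
      fix lss :: "'a list list"
      assume "[] \<notin> set lss" "weight lss = Suc (weight kss)" "degree lss = Suc (degree kss)"
      then show "gens_commutator js * commutator_product lss * 1 \<in> I"
        using cons.IH[of lss] cons.prems cons.hyps by auto
    qed (use closed cons.prems in auto)
    moreover have "commutator_product ((j # js) # kss) =
        commutator (gen j) (gens_commutator js * commutator_product kss)
        - gens_commutator js * commutator (gen j) (commutator_product kss) * 1"
      using cons.hyps by (simp add: gens_commutator_Cons commutator_mult_right)
    ultimately show ?case using closed(3) by metis
  qed
  then show ?thesis using jss by (cases jss) auto
qed

lemma commutator_product_in_S:
  fixes jss :: "'g list list"
  defines "p \<equiv> commutator_product jss :: ('g, 'k::field) free_algebra"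
  assumes jss: "jss \<noteq> []" "\<And>js. js \<in> set jss \<Longrightarrow> length js \<ge> 2"
    and p: "p \<noteq> 0" "maximal_inclusion i p"
  shows "p \<in> S i"
proof -
  have "gens_commutator js \<noteq> (0 :: ('g, 'k) free_algebra)" if "js \<in> set jss" for js
    using split_list[OF that] p(1) by (auto simp: p_def)
  then have "\<exists>m\<ge>2. pure_commutator m (gens_commutator js :: ('g, 'k) free_algebra)"
    if "js \<in> set jss" for js
    using that jss(2)[OF that] unfolding pure_commutator_def
    by (intro exI[of _ "length js"]) (auto simp: gens_commutator_def)
  then have "pure_commutator_product_ge2 p"
    unfolding pure_commutator_product_ge2_def using jss(1) p(1)
    by (intro exI[of _ "map gens_commutator jss"]) (auto simp: p_def commutator_product_def)
  then show ?thesis using p(2) by (simp add: S_def)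
qed

lemma commutator_product_in_ideal_S:
  fixes jss :: "two list list"
  assumes "n \<ge> 1" "[] \<notin> set jss" "n \<le> weight jss"
  shows "(commutator_product jss :: 'k::field_char_0 A2) \<in> ideal_generated_by (S (Suc n))"
  using assms(2,3)
proof (induction "degree jss" arbitrary: jss rule: less_induct)
  case less
  let ?I = "ideal_generated_by (S (Suc n)) :: 'k A2 set"
  have I: "two_sided_ideal ?I" by (rule ideal_generated_by_ideal)
  \<comment> \<open>Equal degree is allowed here without circularity: the extra weight lets the
    reduction use only products of strictly smaller degree.\<close>
  have reduction: "commutator_product kss \<in> ?I"
    if "[] \<notin> set kss" "Suc n \<le> weight kss" "degree kss \<le> degree jss" for kss
    using commutator_product_weight_reduction[OF I _ that] less.hyps by blast
  consider "Suc n \<le> weight jss" | j where "[j] \<in> set jss" "weight jss = n"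
    | "\<And>js. js \<in> set jss \<Longrightarrow> length js \<ge> 2" "weight jss = n"
  proof -
    have "length js \<ge> 2 \<or> (\<exists>j. js = [j])" if "js \<in> set jss" for js
    proof (cases js)
      case (Cons j ks)
      then show ?thesis by (cases ks) auto
    qed (use that less.prems in auto)
    then have "(\<forall>js\<in>set jss. length js \<ge> 2) \<or> (\<exists>j. [j] \<in> set jss)" by metis
    moreover have "weight jss = n \<or> Suc n \<le> weight jss" using less.prems by linarith
    ultimately show ?thesis using that by blast
  qed
  then show ?case
  proof cases
    case 1
    then show ?thesis using reduction less.prems by blast
  next
    case (2 j)
    \<comment> \<open>The bare generator is moved to the front. Deleting it lowers the degree and
      keeps the weight; the correction terms have weight \<open>n + 1\<close> and unchanged
      degree.\<close>
    obtain xs ys where jss: "jss = xs @ [j] # ys" using split_list[OF 2(1)] by blast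
    have "commutator_product (xs @ ys) \<in> ?I"
      using less.hyps[of "xs @ ys"] less.prems jss by auto
    then have "gen j * (commutator_product xs * commutator_product ys) \<in> ?I"
      using I by (simp add: ideal_mult_left)
    moreover have "1 * commutator (gen j) (commutator_product xs) * commutator_product ys \<in> ?I"
    proof (rule commutator_product_derivation)
      fix kss :: "two list list"
      assume "[] \<notin> set kss" "weight kss = Suc (weight xs)" "degree kss = Suc (degree xs)"
      then show "1 * commutator_product kss * commutator_product ys \<in> ?I"
        using reduction[of "kss @ ys"] less.prems 2 jss by auto
    qed (use I less.prems jss in \<open>auto intro: ideal_zero ideal_add\<close>)
    moreover have "commutator_product jss =
        gen j * (commutator_product xs * commutator_product ys)
        - 1 * commutator (gen j) (commutator_product xs) * commutator_product ys"
      by (simp add: jss commutator_def algebra_simps)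
    ultimately show ?thesis using ideal_diff[OF I] by metis
  next
    case 3
    let ?p = "commutator_product jss :: 'k A2"
    have p: "?p \<in> M (Suc n)"
      using commutator_product_in_M[OF less.prems(1)] 3 by simp
    show ?thesis
    proof (cases "?p = 0 \<or> ?p \<notin> M (Suc (Suc n))")
      case True
      have "jss \<noteq> []" using 3 \<open>n \<ge> 1\<close> by auto
      then have "?p \<in> S (Suc n)" if "?p \<noteq> 0"
        using that True p 3(1)
        by (intro commutator_product_in_S) (auto simp: maximal_inclusion_def)
      then show ?thesis
        using ideal_zero[OF I] ideal_generated_by_base by (cases "?p = 0") auto
    next
      case False
      \<comment> \<open>Here \<open>?p\<close> is not a generator from \<open>S (Suc n)\<close>, but
        homogeneity rewrites it through products of the same degree and larger weight.\<close>
      then have "?p \<in> weight_space (Suc n)" using M_subset_weight_space by blast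
      then show ?thesis
        by (rule homogeneous_weight_space[OF ideal_subspace[OF I] _
            homogeneous_commutator_product[OF less.prems(1)]]) (rule reduction, simp_all)
    qed
  qed
qed

section \<open>Finiteness of the generating set\<close>

lemma length_le_weight:
  "(\<And>js. js \<in> set jss \<Longrightarrow> length js \<ge> 2) \<Longrightarrow> length jss \<le> weight jss"
  by (induction jss) force+

lemma length_mem_le_weight: "js \<in> set jss \<Longrightarrow> length js \<le> Suc (weight jss)"
  by (induction jss) auto

text \<open>Weight below \<open>i\<close> bounds both the number and the lengths of the factors, and
  the alphabet is finite.\<close>

lemma finite_S: "finite (S i :: 'k::field_char_0 A2 set)"
proof -
  let ?B = "{js :: two list. set js \<subseteq> UNIV \<and> length js \<le> Suc i}"
  let ?C = "{jss. set jss \<subseteq> ?B \<and> length jss \<le> i}"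
  have "finite (UNIV :: two set)"
    by (rule finite_subset[of _ "{X1, X2}"]) (auto intro: two.exhaust)
  then have "finite ?C"
    by (intro finite_lists_length_le)
  moreover have "S i \<subseteq> (commutator_product ` ?C :: 'k A2 set)"
  proof
    fix p :: "'k A2"
    assume p: "p \<in> S i"
    then obtain cs where cs: "\<And>c. c \<in> set cs \<Longrightarrow> \<exists>m\<ge>2. pure_commutator m c" "p = prod_list cs"
      by (auto simp: S_def pure_commutator_product_ge2_def)
    have "\<exists>js. length js \<ge> 2 \<and> c = gens_commutator js" if "c \<in> set cs" for c
      using cs(1)[OF that] by (auto simp: pure_commutator_def gens_commutator_def)
    then obtain f where f: "\<And>c. c \<in> set cs \<Longrightarrow> length (f c) \<ge> 2 \<and> c = gens_commutator (f c)"
      by metis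
    define jss where "jss = map f cs"
    have p_eq: "p = commutator_product jss"
      using f cs(2) by (auto simp: jss_def commutator_product_def comp_def intro!: map_idI[symmetric]
        arg_cong[where f = prod_list])
    have jss: "length js \<ge> 2" if "js \<in> set jss" for js
      using that f by (auto simp: jss_def)
    then have nonempty: "[] \<notin> set jss" by force
    \<comment> \<open>Weight \<open>i\<close> already forces membership in \<open>M (Suc i)\<close>,
      against maximal inclusion.\<close>
    have "\<not> i \<le> weight jss"
    proof
      assume "i \<le> weight jss"
      then have "p \<in> M (Suc i)"
        using commutator_product_in_M[OF nonempty] M_antimono[of "Suc i" "Suc (weight jss)"] p_eq
        by auto
      then show False using p by (simp add: S_def maximal_inclusion_def)
    qed
    then have "jss \<in> ?C"
      using length_le_weight[OF jss] length_mem_le_weight[of _ jss] by fastforce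
    then show "p \<in> commutator_product ` ?C" using p_eq by blast
  qed
  ultimately show ?thesis by (rule finite_surj)
qed

theorem theorem3p5:
  fixes i :: nat
  assumes "i \<ge> 2"
  shows "finite (S i :: 'k::field_char_0 A2 set) \<and>
         ideal_generated_by (S i :: 'k A2 set) = M i"
proof (intro conjI equalityI)
  show "finite (S i :: 'k A2 set)" by (rule finite_S)
  show "ideal_generated_by (S i :: 'k A2 set) \<subseteq> M i"
    by (intro ideal_generated_by_minimal M_ideal) (auto simp: S_def maximal_inclusion_def)
  obtain n where n: "i = Suc n" "n \<ge> 1" using assms by (cases i) auto
  \<comment> \<open>Index \<open>i\<close> corresponds to weight \<open>n = i - 1\<close>, so
    \<open>M i\<close> lies in this span of products.\<close>
  have "weight_space n \<subseteq> (ideal_generated_by (S (Suc n)) :: 'k A2 set)"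
    using commutator_product_in_ideal_S[OF n(2)]
    by (intro weight_space_minimal ideal_subspace ideal_generated_by_ideal)
  then show "M i \<subseteq> (ideal_generated_by (S i) :: 'k A2 set)"
    using M_subset_weight_space[of n] n by blast
qed

end
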